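(* Let $n\ge 2$. The automorphisms of the Einstein gyrogroup $(\mathbb{B}^n,\oplus)$ are precisely the restrictions to $\mathbb{B}^n$ of the orthogonal transformations of $\mathbb{R}^n$. That is, a map $f:\mathbb{B}^n\to\mathbb{B}^n$ is a bijection satisfying $f(u\oplus v)=f(u)\oplus f(v)$ for all $u,v\in\mathbb{B}^n$ if and only if there is an orthogonal linear transformation $T:\mathbb{R}^n\to\mathbb{R}^n$ such that $f(u)=T(u)$ for all $u\in\mathbb{B}^n$.
   Context: For a positive integer $n$, $\mathbb{B}^n=\{u\in\mathbb{R}^n: |u|<1\}$ is the open unit ball, where $(u,v)$ denotes the standard inner product on $\mathbb{R}^n$ and $|u|=\sqrt{(u,u)}$ the Euclidean norm. The $n$-dimensional Einstein gyrogroup is $\mathbb{B}^n$ with the binary operation $$u\oplus v=\frac{1}{1+(u,v)}\left(u+\sqrt{1-|u|^2}\, v+\frac{(u,v)}{1+\sqrt{1-|u|^2}}\, u\right),$$ which maps $\mathbb{B}^n\times\mathbb{B}^n$ to $\mathbb{B}^n$. An endomorphism of $(\mathbb{B}^n,\oplus)$ is a map $f:\mathbb{B}^n\to\mathbb{B}^n$ with $f(u\oplus v)=f(u)\oplus f(v)$ for all $u,v\in\mathbb{B}^n$; an automorphism is a bijective endomorphism (no continuity is assumed). *)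

theory Defs
  imports "HOL-Analysis.Analysis"
begin

abbreviation unit_ball :: "(real ^ 'n) set" where
  "unit_ball \<equiv> ball 0 1"

text \<open>The formula is given on the whole space; it is only meaningful, and only used,
  for arguments in the open unit ball.\<close>

definition einstein_add :: "real ^ 'n \<Rightarrow> real ^ 'n \<Rightarrow> real ^ 'n"  (infixl \<open>\<oplus>\<^sub>E\<close> 65) where
  "u \<oplus>\<^sub>E v =
     (1 / (1 + u \<bullet> v)) *\<^sub>R
       (u + sqrt (1 - (norm u)\<^sup>2) *\<^sub>R v
          + ((u \<bullet> v) / (1 + sqrt (1 - (norm u)\<^sup>2))) *\<^sub>R u)"

text \<open>A self-map of the ball is represented by a total function on the ambient space;
  its values outside the ball are unconstrained.\<close>

definition einstein_endomorphism :: "(real ^ 'n \<Rightarrow> real ^ 'n) \<Rightarrow> bool" where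
  "einstein_endomorphism f \<longleftrightarrow>
     f \<in> unit_ball \<rightarrow> unit_ball \<and>
     (\<forall>u\<in>unit_ball. \<forall>v\<in>unit_ball. f (u \<oplus>\<^sub>E v) = f u \<oplus>\<^sub>E f v)"

definition einstein_automorphism :: "(real ^ 'n \<Rightarrow> real ^ 'n) \<Rightarrow> bool" where
  "einstein_automorphism f \<longleftrightarrow>
     einstein_endomorphism f \<and> bij_betw f unit_ball unit_ball"

end

theory Submission
  imports Defs
begin

text \<open>Let \<open>\<gamma> u = 1 / sqrt (1 - |u|\<^sup>2)\<close>, so that \<open>\<gamma> (u \<oplus> v) = \<gamma> u * \<gamma> v * (1 + u \<bullet> v)\<close>; in particular
  \<open>u \<oplus> v\<close> and \<open>v \<oplus> u\<close> have the same norm. Two vectors of equal norm at a small angle are of the form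
  \<open>a \<oplus> b\<close>, \<open>b \<oplus> a\<close>, so an endomorphism \<open>f\<close> maps them to vectors of equal norm; as spheres are
  connected for \<open>n \<ge> 2\<close>, \<open>\<gamma> (f u) = g (\<gamma> u)\<close> for some function \<open>g\<close> on \<open>[1, \<infinity>)\<close>. Orthogonality of
  \<open>u\<close> and \<open>v\<close> means that \<open>u \<oplus> v\<close> and \<open>u \<oplus> (-v)\<close> have equal norm, so it is preserved too. Adding
  orthogonal vectors shows that \<open>g\<close> is multiplicative, hence monotone since \<open>g \<ge> 1\<close>, and \<open>u \<oplus> u\<close> gives
  \<open>g (2s\<^sup>2 - 1) = 2 (g s)\<^sup>2 - 1\<close>. These force \<open>g = id\<close> unless \<open>g = 1\<close>, that is, \<open>f = 0\<close>. Then \<open>f\<close>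
  preserves \<open>\<gamma>\<close>, hence inner products.\<close>

section \<open>Lorentz factors, inverses and swapped sums\<close>

definition lorentz :: "real ^ 'n \<Rightarrow> real" where
  "lorentz u = 1 / sqrt (1 - u \<bullet> u)"

lemma inner_self_less_1: "u \<in> unit_ball \<Longrightarrow> u \<bullet> u < 1"
  by (simp add: dot_square_norm power_less_one_iff abs_square_less_1)

lemma in_unit_ball_iff: "u \<in> unit_ball \<longleftrightarrow> u \<bullet> u < 1"
  by (simp add: norm_eq_sqrt_inner)

lemma one_plus_inner_pos:
  fixes u v :: "real ^ 'n"
  assumes "u \<in> unit_ball" "v \<in> unit_ball"
  shows "1 + u \<bullet> v > 0"
proof -
  have "0 \<le> (u + v) \<bullet> (u + v)" by simp
  then have "0 \<le> u \<bullet> u + v \<bullet> v + 2 * (u \<bullet> v)"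
    by (simp add: inner_add_left inner_add_right inner_commute)
  then show ?thesis using assms[THEN inner_self_less_1] by linarith
qed

lemma einstein_add_alt:
  "u \<oplus>\<^sub>E v = (1 / (1 + u \<bullet> v)) *\<^sub>R
     ((1 + (u \<bullet> v) / (1 + sqrt (1 - u \<bullet> u))) *\<^sub>R u + sqrt (1 - u \<bullet> u) *\<^sub>R v)"
  unfolding einstein_add_def power2_norm_eq_inner by (simp add: algebra_simps)

text \<open>This is the product formula for Lorentz factors, inverted and squared. Its right-hand
  side is symmetric in \<open>u\<close> and \<open>v\<close>, although the operation is not
  commutative.\<close>

lemma one_minus_inner_self_einstein_add:
  fixes u v :: "real ^ 'n"
  assumes "u \<in> unit_ball" "v \<in> unit_ball"
  shows "1 - (u \<oplus>\<^sub>E v) \<bullet> (u \<oplus>\<^sub>E v) = (1 - u \<bullet> u) * (1 - v \<bullet> v) / (1 + u \<bullet> v)\<^sup>2"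
proof -
  define s where "s = sqrt (1 - u \<bullet> u)"
  define p where "p = u \<bullet> v"
  define k where "k = 1 + p / (1 + s)"
  have p: "1 + p > 0" using one_plus_inner_pos[OF assms] by (simp add: p_def)
  have s: "s > 0" and s2: "u \<bullet> u = 1 - s^2"
    using inner_self_less_1[OF assms(1)] by (auto simp: s_def)
  \<comment> \<open>Clearing the denominator here lets \<open>p\<close> be eliminated below, which
    turns the expansion of \<open>w \<bullet> w\<close> into a polynomial identity in
    \<open>k\<close> and \<open>s\<close>.\<close>
  have kp: "(k - 1) * (1 + s) = p" using s by (simp add: k_def)
  define w where "w = k *\<^sub>R u + s *\<^sub>R v"
  have "w \<bullet> w = k^2 * (1 - s^2) + 2 * k * s * p + s^2 * (v \<bullet> v)"
    by (simp add: w_def inner_add_left inner_add_right inner_commute[of v u] p_def[symmetric] s2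
        power2_eq_square algebra_simps)
  moreover have "u \<oplus>\<^sub>E v = (1 / (1 + p)) *\<^sub>R w"
    unfolding einstein_add_alt s_def[symmetric] p_def[symmetric] k_def[symmetric] w_def ..
  ultimately have "(u \<oplus>\<^sub>E v) \<bullet> (u \<oplus>\<^sub>E v) = (k^2 * (1 - s^2) + 2 * k * s * p + s^2 * (v \<bullet> v)) / (1 + p)^2"
    by (simp add: power2_eq_square)
  moreover have "k^2 * (1 - s^2) + 2 * k * s * p = (1 + p)^2 - s^2"
    unfolding kp[symmetric] by algebra
  ultimately show ?thesis using p unfolding p_def[symmetric] s2
    by (simp add: field_simps)
qed

lemma lorentz_ge_1: "u \<in> unit_ball \<Longrightarrow> lorentz u \<ge> 1"
  using inner_self_less_1[of u] by (simp add: lorentz_def)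

lemma inner_self_eq_lorentz: "u \<in> unit_ball \<Longrightarrow> u \<bullet> u = 1 - 1 / (lorentz u)\<^sup>2"
  using inner_self_less_1[of u] by (simp add: lorentz_def power_divide)

lemma lorentz_einstein_add:
  fixes u v :: "real ^ 'n"
  assumes "u \<in> unit_ball" "v \<in> unit_ball"
  shows "lorentz (u \<oplus>\<^sub>E v) = lorentz u * lorentz v * (1 + u \<bullet> v)"
  using one_plus_inner_pos[OF assms]
  unfolding lorentz_def one_minus_inner_self_einstein_add[OF assms]
  by (simp add: real_sqrt_divide real_sqrt_mult)

lemma einstein_add_closed:
  fixes u v :: "real ^ 'n"
  assumes "u \<in> unit_ball" "v \<in> unit_ball"
  shows "u \<oplus>\<^sub>E v \<in> unit_ball"
proof -
  have "(1 - u \<bullet> u) * (1 - v \<bullet> v) / (1 + u \<bullet> v)\<^sup>2 > 0"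
    using assms[THEN inner_self_less_1] one_plus_inner_pos[OF assms] by simp
  then show ?thesis
    unfolding in_unit_ball_iff using one_minus_inner_self_einstein_add[OF assms] by linarith
qed

lemma einstein_add_uminus:
  fixes u :: "real ^ 'n"
  assumes "u \<in> unit_ball"
  shows "u \<oplus>\<^sub>E (- u) = 0"
proof -
  define s where "s = sqrt (1 - u \<bullet> u)"
  have s: "s > 0" and s2: "u \<bullet> u = 1 - s^2"
    using inner_self_less_1[OF assms(1)] by (auto simp: s_def)
  have "1 + (s^2 - 1) / (1 + s) = s"
    using s by (simp add: field_simps power2_eq_square)
  then show ?thesis
    unfolding einstein_add_alt s_def[symmetric] by (simp add: s2)
qed

text \<open>A vanishing sum is a linear relation between \<open>u\<close> and \<open>v\<close>; its
  inner product with \<open>u\<close> determines the ratio of the coefficients. This uniqueness of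
  inverses makes endomorphisms commute with negation.\<close>

lemma einstein_add_eq_0_imp:
  fixes u v :: "real ^ 'n"
  assumes uv: "u \<in> unit_ball" "v \<in> unit_ball" and 0: "u \<oplus>\<^sub>E v = 0"
  shows "v = - u"
proof -
  define s where "s = sqrt (1 - u \<bullet> u)"
  define p where "p = u \<bullet> v"
  define k where "k = 1 + p / (1 + s)"
  have s: "s > 0" and s2: "u \<bullet> u = 1 - s^2"
    using inner_self_less_1[OF uv(1)] by (auto simp: s_def)
  have kp: "(k - 1) * (1 + s) = p" using s by (simp add: k_def)
  have kv: "k *\<^sub>R u + s *\<^sub>R v = 0"
    using 0 one_plus_inner_pos[OF uv]
    unfolding einstein_add_alt s_def[symmetric] p_def[symmetric] k_def[symmetric] by auto
  have "u \<bullet> (k *\<^sub>R u + s *\<^sub>R v) = 0" by (simp add: kv)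
  then have "k * (1 - s^2) + s * p = 0"
    by (simp add: inner_add_right s2 p_def)
  then have "(1 + s) * (k - s) = 0"
    unfolding kp[symmetric] by algebra
  then have "k = s" using s by simp
  then have "s *\<^sub>R (u + v) = 0" using kv by (simp add: scaleR_add_right)
  then show ?thesis using s by (simp add: add_eq_0_iff)
qed

text \<open>For an idempotent the product formula leaves
  \<open>lorentz u * (1 + u \<bullet> u) = 1\<close> with both factors at least 1. Applied to
  \<open>f 0\<close>, this gives \<open>f 0 = 0\<close>.\<close>

lemma einstein_add_self_eq_imp:
  fixes u :: "real ^ 'n"
  assumes u: "u \<in> unit_ball" and e: "u \<oplus>\<^sub>E u = u"
  shows "u = 0"
proof -
  have "lorentz u = lorentz u * lorentz u * (1 + u \<bullet> u)"
    using lorentz_einstein_add[OF u u] e by simp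
  then have "1 = lorentz u * (1 + u \<bullet> u)" using lorentz_ge_1[OF u] by simp
  moreover have "lorentz u * (1 + u \<bullet> u) \<ge> 1 * (1 + u \<bullet> u)"
    using lorentz_ge_1[OF u] by (intro mult_right_mono) auto
  ultimately show ?thesis using inner_ge_zero[of u] by (simp add: order_antisym)
qed

text \<open>Rotating \<open>u\<close> to \<open>v\<close> by a gyration: \<open>a\<close> is sought orthogonal to \<open>u\<close> in the plane of \<open>u\<close>
  and \<open>v\<close> with \<open>(- a \<oplus> u) \<oplus> a = v\<close>. With \<open>t = sqrt (1 - |u|\<^sup>2)\<close>, \<open>s = sqrt (1 - |a|\<^sup>2)\<close>,
  the cosine of the angle of rotation is \<open>c = (s + t) / (1 + s t)\<close>, so that every \<open>c\<close> in \<open>(t, 1]\<close> is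
  attained by an explicit \<open>s\<close>.\<close>

lemma swapped_sum_exists:
  fixes u v :: "real ^ 'n"
  assumes u: "u \<in> unit_ball" "u \<noteq> 0" and uv: "v \<bullet> v = u \<bullet> u"
    and angle: "sqrt (1 - u \<bullet> u) * (u \<bullet> u) < u \<bullet> v"
  obtains a b where "a \<in> unit_ball" "b \<in> unit_ball" "a \<oplus>\<^sub>E b = u" "b \<oplus>\<^sub>E a = v"
proof -
  define t where "t = sqrt (1 - u \<bullet> u)"
  define r where "r = u \<bullet> u"
  define c where "c = (u \<bullet> v) / r"
  \<comment> \<open>This solves \<open>c = (s + t) / (1 + s * t)\<close> for \<open>s\<close>; the
    angle hypothesis says \<open>t < c\<close> and so makes \<open>s\<close> positive.\<close>
  define s where "s = (c - t) / (1 - c * t)"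
  define a where "a = (1 / r) *\<^sub>R ((s + t) *\<^sub>R u - (1 + s * t) *\<^sub>R v)"
  \<comment> \<open>This is \<open>(- a) \<oplus>\<^sub>E u\<close>, whose inner product terms
    vanish because \<open>a\<close> is orthogonal to \<open>u\<close>.\<close>
  define b where "b = s *\<^sub>R u - a"
  have r: "r > 0" "r < 1" using u inner_self_less_1[OF u(1)] by (auto simp: r_def)
  have t: "t > 0" "t < 1" "t^2 = 1 - r" using r by (auto simp: t_def r_def)
  have c1: "c \<le> 1"
  proof -
    have "0 \<le> (u - v) \<bullet> (u - v)" by simp
    then have "u \<bullet> v \<le> r"
      by (simp add: inner_diff_left inner_diff_right inner_commute uv r_def)
    then show ?thesis using r by (simp add: c_def)
  qed
  have ct: "t < c" using angle r by (simp add: c_def t_def r_def field_simps)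
  have uvc: "u \<bullet> v = c * r" using r by (simp add: c_def)
  have "c * t \<le> 1 * t" by (rule mult_right_mono) (use c1 t in auto)
  then have d: "1 - c * t > 0" using t by linarith
  have s0: "s > 0" using ct d by (simp add: s_def)
  have "(1 - c) * (1 + t) \<ge> 0" using c1 t by simp
  then have s1: "s \<le> 1" using d by (simp add: s_def field_simps)
  have st: "c * (1 + s * t) = s + t"
    using d by (simp add: s_def field_simps)
  have st0: "1 + s * t > 0" using s0 t by (simp add: add_pos_pos)
  have au: "a \<bullet> u = 0"
    unfolding a_def using r st
    by (simp add: inner_diff_left inner_commute[of v u] uvc r_def[symmetric] algebra_simps)
  have aa: "a \<bullet> a = 1 - s^2"
  proof -
    \<comment> \<open>Only the second factor is expanded; its component along \<open>u\<close> drops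
      out by orthogonality.\<close>
    have "a \<bullet> a = (1/r) * (- (1 + s * t) * (a \<bullet> v))"
      by (subst (2) a_def) (simp add: inner_diff_right au minus_divide_left[symmetric] del: minus_add_distrib)
    also have "a \<bullet> v = (1/r) * ((s + t) * (c * r) - (1 + s * t) * r)"
      by (simp add: a_def inner_diff_left uvc uv r_def[symmetric])
    also have "\<dots> = (s + t) * c - (1 + s * t)" using r by (simp add: field_simps)
    also have "- (1 + s * t) * ((s + t) * c - (1 + s * t)) = (1 + s * t)^2 - (s + t)^2"
      unfolding st[symmetric] by algebra
    also have "\<dots> = (1 - s^2) * r" using t(3) by algebra
    finally show ?thesis using r by simp
  qed
  have ab: "a \<bullet> b = s^2 - 1" by (simp add: b_def inner_diff_right au aa)
  have bb: "b \<bullet> b = 1 - (s * t)^2"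
    unfolding b_def
    by (simp add: inner_diff_left inner_diff_right au aa inner_commute[of u a] r_def[symmetric]
        power_mult_distrib t(3)) (simp add: power2_eq_square algebra_simps)
  have sa: "sqrt (1 - a \<bullet> a) = s" using s0 by (simp add: aa)
  have sb: "sqrt (1 - b \<bullet> b) = s * t" using s0 t by (simp add: bb)
  have k1: "1 + (s^2 - 1) / (1 + s) = s" using s0 by (simp add: field_simps power2_eq_square)
  have aub: "a \<oplus>\<^sub>E b = u"
    unfolding einstein_add_alt sa unfolding ab k1 using s0
    by (simp add: b_def scaleR_diff_right power2_eq_square)
  have k2: "1 + (s^2 - 1) / (1 + s * t) = s * (s + t) / (1 + s * t)"
    using st0 by (simp add: field_simps power2_eq_square)
  have av: "r *\<^sub>R a = (s + t) *\<^sub>R u - (1 + s * t) *\<^sub>R v" using r by (simp add: a_def)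
  have "(1 + s * t) *\<^sub>R v = (s + t) *\<^sub>R u - r *\<^sub>R a" by (simp add: av)
  then have v: "v = (1 / (1 + s * t)) *\<^sub>R ((s + t) *\<^sub>R u - r *\<^sub>R a)"
    using st0 by (metis scaleR_scaleR divide_self_if less_irrefl nonzero_divide_eq_eq scaleR_one times_divide_eq_left)
  \<comment> \<open>The coefficient of \<open>a\<close> in the sum: by \<open>t^2 = 1 - r\<close> it
    contains the factor \<open>s^2\<close>, which cancels the denominator
    \<open>1 + a \<bullet> b = s^2\<close>.\<close>
  have k3: "s * t - s * (s + t) / (1 + s * t) = s^2 * (- r / (1 + s * t))"
    using st0 t(3) by (simp add: field_simps power2_eq_square) algebra
  have "b \<oplus>\<^sub>E a = (1 / s^2) *\<^sub>R ((s * (s + t) / (1 + s * t)) *\<^sub>R (s *\<^sub>R u - a) + (s * t) *\<^sub>R a)"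
    unfolding einstein_add_alt sb inner_commute[of b a] unfolding ab k2 by (simp add: b_def)
  also have "\<dots> = (1 / s^2) *\<^sub>R ((s^2 * ((s + t) / (1 + s * t))) *\<^sub>R u
      + (s * t - s * (s + t) / (1 + s * t)) *\<^sub>R a)"
    by (simp add: algebra_simps power2_eq_square)
  also have "\<dots> = ((s + t) / (1 + s * t)) *\<^sub>R u + (- r / (1 + s * t)) *\<^sub>R a"
    unfolding k3 scaleR_add_right scaleR_scaleR using s0 by simp
  also have "\<dots> = v" unfolding v by (simp add: scaleR_diff_right)
  finally have bva: "b \<oplus>\<^sub>E a = v" .
  show ?thesis
  proof
    show "a \<in> unit_ball" using s0 by (simp only: in_unit_ball_iff) (simp add: aa)
    show "b \<in> unit_ball" using s0 t by (simp only: in_unit_ball_iff) (simp add: bb)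
  qed (fact aub bva)+
qed

section \<open>A functional equation on the Lorentz factors\<close>

text \<open>Monotonicity replaces continuity: once \<open>g 2 = 2\<close> is known, the powers of 2
  confine \<open>g\<close> to within a factor 2 of the identity, and multiplicativity removes that
  factor. The rule \<open>dbl\<close> is the formula for \<open>u \<oplus>\<^sub>E u\<close> written
  in terms of the squared Lorentz factor.\<close>

lemma multiplicative_doubling_imp_id:
  fixes g :: "real \<Rightarrow> real"
  assumes ge: "\<And>s. s \<ge> 1 \<Longrightarrow> g s \<ge> 1"
    and mult: "\<And>s t. s \<ge> 1 \<Longrightarrow> t \<ge> 1 \<Longrightarrow> g (s * t) = g s * g t"
    and dbl: "\<And>s. s \<ge> 1 \<Longrightarrow> g (2 * s - 1) = 2 * g s - 1"
    and nontriv: "\<exists>s\<ge>1. g s \<noteq> 1"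
    and x: "x \<ge> 1"
  shows "g x = x"
proof -
  have mono: "g s \<le> g t" if "1 \<le> s" "s \<le> t" for s t
  proof -
    have "g t = g s * g (t / s)" using mult[of s "t / s"] that by simp
    moreover have "g s * g (t / s) \<ge> g s * 1"
      by (rule mult_left_mono) (use that ge[of s] ge[of "t/s"] in auto)
    ultimately show ?thesis by simp
  qed
  have g1: "g 1 = 1" using dbl[of 1] by simp
  have pow: "g (s ^ n) = g s ^ n" if "s \<ge> 1" for s n
    by (induction n) (use that in \<open>simp_all add: g1 mult\<close>)
  have "g 3 = 2 * g 2 - 1" "g 5 = 2 * g 3 - 1" "g 9 = 2 * g 5 - 1" "g 9 = g 3 * g 3"
    using dbl[of 2] dbl[of 3] dbl[of 5] mult[of 3 3] by simp_all
  \<comment> \<open>Computing \<open>g 9\<close> by doubling and as a square leaves only two candidates for \<open>g 2\<close>.\<close>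
  then have "(g 2 - 1) * (g 2 - 2) = 0" by algebra
  moreover have "g 2 \<noteq> 1"
  proof
    assume 2: "g 2 = 1"
    have "g s = 1" if "s \<ge> 1" for s
    proof -
      obtain n where "s < 2 ^ n" using real_arch_pow[of 2 s] by auto
      then have "g s \<le> 1" using mono[of s "2 ^ n"] pow[of 2 n] that 2 by simp
      then show ?thesis using ge[OF that] by simp
    qed
    then show False using nontriv by blast
  qed
  ultimately have g2: "g 2 = 2" by simp
  \<comment> \<open>Comparison with powers of 2; applied to \<open>y = x ^ n\<close> for all \<open>n\<close>, it pins down \<open>g x\<close>.\<close>
  have bounds: "g y \<le> 2 * y \<and> y \<le> 2 * g y" if "y \<ge> 1" for y
  proof -
    obtain m where m: "2 ^ m \<le> y" "y < 2 ^ Suc m"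
    proof -
      obtain n where n: "y < 2 ^ n" "\<And>k. k < n \<Longrightarrow> \<not> y < 2 ^ k"
        using real_arch_pow[of 2 y] exists_least_iff[of "\<lambda>n. y < 2 ^ n"] by auto
      with \<open>y \<ge> 1\<close> have "n \<noteq> 0" by (metis power_0 not_le)
      then obtain k where "n = Suc k" by (cases n) auto
      with n that show thesis using that[of k] by (metis lessI not_le)
    qed
    have "2 ^ m \<le> g y" "g y \<le> 2 ^ Suc m"
      using mono[of "2 ^ m" y] mono[of y "2 ^ Suc m"] pow[of 2 m] pow[of 2 "Suc m"] m that g2
      by simp_all
    then show ?thesis using m by simp
  qed
  have gx: "g x \<ge> 1" using ge x by simp
  have no: "\<not> z > 1" if "\<And>n. z ^ n \<le> 2" for z :: real
    using that real_arch_pow[of z 2] by (meson not_le)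
  have xn: "1 \<le> x ^ n" for n using x by simp
  have "(g x / x) ^ n \<le> 2" "(x / g x) ^ n \<le> 2" for n
    using bounds[OF xn[of n]] pow[OF x, of n] x gx by (simp_all add: power_divide field_simps)
  then have "\<not> g x / x > 1" "\<not> x / g x > 1" using no by blast+
  then show ?thesis using x gx by (simp add: field_simps)
qed

section \<open>Endomorphisms and their invariants\<close>

lemma endomorphism_in_ball:
  "einstein_endomorphism f \<Longrightarrow> u \<in> unit_ball \<Longrightarrow> f u \<in> unit_ball"
  unfolding einstein_endomorphism_def by blast

lemma endomorphism_add:
  "einstein_endomorphism f \<Longrightarrow> u \<in> unit_ball \<Longrightarrow> v \<in> unit_ball \<Longrightarrow> f (u \<oplus>\<^sub>E v) = f u \<oplus>\<^sub>E f v"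
  unfolding einstein_endomorphism_def by blast

lemma endomorphism_0:
  assumes "einstein_endomorphism f"
  shows "f 0 = 0"
proof (rule einstein_add_self_eq_imp)
  show "f 0 \<in> unit_ball" by (rule endomorphism_in_ball[OF assms]) simp
  show "f 0 \<oplus>\<^sub>E f 0 = f 0"
    using endomorphism_add[OF assms, of 0 0] by (simp add: einstein_add_def)
qed

lemma endomorphism_uminus:
  fixes u :: "real ^ 'n"
  assumes f: "einstein_endomorphism f" and u: "u \<in> unit_ball"
  shows "f (- u) = - f u"
proof (rule einstein_add_eq_0_imp)
  have u': "- u \<in> unit_ball" using u by simp
  show "f u \<in> unit_ball" "f (- u) \<in> unit_ball" using endomorphism_in_ball[OF f] u u' by blast+
  show "f u \<oplus>\<^sub>E f (- u) = 0"
    using endomorphism_add[OF f u u'] by (simp add: einstein_add_uminus[OF u] endomorphism_0[OF f])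
qed

text \<open>Swapped sums compare only vectors at a small angle, which gives local constancy on a
  sphere; connectedness then covers all angles without any continuity of \<open>f\<close>.\<close>

lemma endomorphism_lorentz_cong:
  fixes u v :: "real ^ 'n"
  assumes n: "CARD('n) \<ge> 2" and f: "einstein_endomorphism f"
    and uv: "u \<in> unit_ball" "v \<in> unit_ball" and eq: "norm u = norm v"
  shows "lorentz (f u) = lorentz (f v)"
proof (cases "u = 0")
  case True
  then show ?thesis using eq by simp
next
  case False
  define S where "S = sphere (0 :: real ^ 'n) (norm u)"
  have "connected S" unfolding S_def using n by (intro connected_sphere) simp
  have "(\<lambda>x. lorentz (f x)) constant_on S"
  proof (rule locally_constant_imp_constant[OF \<open>connected S\<close>])
    fix x assume xS: "x \<in> S"
    have x: "norm x = norm u" "x \<in> unit_ball" "x \<noteq> 0" using xS uv(1) False by (auto simp: S_def)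
    \<comment> \<open>The spherical cap around \<open>x\<close> on which the angle hypothesis of
      \<open>swapped_sum_exists\<close> holds. It contains \<open>x\<close> because
      \<open>sqrt (1 - x \<bullet> x) < 1\<close> for \<open>x \<noteq> 0\<close>.\<close>
    define T where "T = S \<inter> {y. sqrt (1 - x \<bullet> x) * (x \<bullet> x) < x \<bullet> y}"
    have op: "openin (top_of_set S) T"
      unfolding T_def by (intro openin_open_Int open_halfspace_gt)
    have "x \<bullet> x > 0" using x by simp
    then have "x \<in> T" using xS by (simp add: T_def)
    moreover have "lorentz (f y) = lorentz (f x)" if "y \<in> T" for y
    proof -
      have "norm y = norm x" using that x by (simp add: T_def S_def)
      then have yy: "y \<bullet> y = x \<bullet> x" by (simp add: dot_square_norm)
      have "sqrt (1 - x \<bullet> x) * (x \<bullet> x) < x \<bullet> y" using that by (simp add: T_def)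
      from swapped_sum_exists[OF x(2,3) yy this]
      obtain a b where ab: "a \<in> unit_ball" "b \<in> unit_ball" "a \<oplus>\<^sub>E b = x" "b \<oplus>\<^sub>E a = y" .
      have "f x = f a \<oplus>\<^sub>E f b" "f y = f b \<oplus>\<^sub>E f a" using endomorphism_add[OF f] ab by metis+
      then show ?thesis using endomorphism_in_ball[OF f] ab(1,2)
        by (simp only: lorentz_einstein_add) (simp add: inner_commute)
    qed
    ultimately show "\<exists>T. openin (top_of_set S) T \<and> x \<in> T \<and> (\<forall>y\<in>T. lorentz (f y) = lorentz (f x))"
      using op by blast
  qed
  moreover have "u \<in> S" "v \<in> S" using eq by (simp_all add: S_def)
  ultimately show ?thesis unfolding constant_on_def by metis
qed

text \<open>The Lorentz factors of the sums of \<open>u\<close> with \<open>v\<close> and with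
  \<open>- v\<close> differ only in the factors \<open>1 + u \<bullet> v\<close> and
  \<open>1 - u \<bullet> v\<close>, so orthogonality can be read off from norms.\<close>

lemma endomorphism_orthogonal:
  fixes u v :: "real ^ 'n"
  assumes n: "CARD('n) \<ge> 2" and f: "einstein_endomorphism f"
    and uv: "u \<in> unit_ball" "v \<in> unit_ball" and orth: "u \<bullet> v = 0"
  shows "f u \<bullet> f v = 0"
proof -
  have v': "- v \<in> unit_ball" using uv by simp
  have fb: "f u \<in> unit_ball" "f v \<in> unit_ball" "f (- v) \<in> unit_ball"
    using endomorphism_in_ball[OF f] uv v' by blast+
  have "1 - (u \<oplus>\<^sub>E v) \<bullet> (u \<oplus>\<^sub>E v) = 1 - (u \<oplus>\<^sub>E (- v)) \<bullet> (u \<oplus>\<^sub>E (- v))"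
    using one_minus_inner_self_einstein_add[OF uv] one_minus_inner_self_einstein_add[OF uv(1) v'] orth
    by simp
  then have "norm (u \<oplus>\<^sub>E v) = norm (u \<oplus>\<^sub>E (- v))" by (simp add: norm_eq_sqrt_inner)
  then have "lorentz (f (u \<oplus>\<^sub>E v)) = lorentz (f (u \<oplus>\<^sub>E (- v)))"
    using endomorphism_lorentz_cong[OF n f] einstein_add_closed uv v' by blast
  then have "lorentz (f u) * lorentz (f v) * (1 + f u \<bullet> f v)
      = lorentz (f u) * lorentz (f (- v)) * (1 + f u \<bullet> f (- v))"
    using endomorphism_add[OF f] uv v' fb by (simp add: lorentz_einstein_add)
  moreover have "lorentz (f (- v)) = lorentz (f v)"
    using endomorphism_lorentz_cong[OF n f v' uv(2)] by simp
  moreover have "lorentz (f u) \<ge> 1" "lorentz (f v) \<ge> 1" using lorentz_ge_1 fb by blast+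
  ultimately show ?thesis by (simp add: endomorphism_uminus[OF f uv(2)])
qed

text \<open>The constant map 0 is an endomorphism that violates the conclusion;
  \<open>nontriv\<close> excludes it.\<close>

lemma endomorphism_lorentz_eq:
  fixes u :: "real ^ 'n"
  assumes n: "CARD('n) \<ge> 2" and f: "einstein_endomorphism f"
    and nontriv: "\<exists>w\<in>unit_ball. f w \<noteq> 0" and u: "u \<in> unit_ball"
  shows "lorentz (f u) = lorentz u"
proof -
  obtain i j :: 'n where ij: "i \<noteq> j"
  proof -
    have "\<not> is_singleton (UNIV :: 'n set)" using n by (simp add: is_singleton_altdef)
    then show thesis using that is_singletonI'[of "UNIV :: 'n set"] by blast
  qed
  \<comment> \<open>The scaling gives \<open>e k s\<close> the Lorentz factor \<open>s\<close>. Two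
    distinct axes supply orthogonal vectors with arbitrary prescribed factors.\<close>
  define e where "e k s = sqrt (1 - 1 / s^2) *\<^sub>R axis k (1::real)" for k :: 'n and s
  define g where "g s = lorentz (f (e i s))" for s
  have sq: "0 \<le> 1 - 1 / s^2" if "s \<ge> 1" for s :: real
    using that by (simp add: divide_le_eq power2_eq_square mult_ge1_I)
  have ee: "e k s \<bullet> e k s = 1 - 1 / s^2" if "s \<ge> 1" for k s
    using sq[OF that] by (simp add: e_def inner_axis_axis)
  have eb: "e k s \<in> unit_ball" if "s \<ge> 1" for k s
    using that by (simp only: in_unit_ball_iff ee) simp
  have le: "lorentz (e k s) = s" if "s \<ge> 1" for k s
    using that by (simp add: lorentz_def ee real_sqrt_divide)
  have g: "lorentz (f w) = g (lorentz w)" if w: "w \<in> unit_ball" for w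
  proof -
    have "w \<bullet> w = e i (lorentz w) \<bullet> e i (lorentz w)"
      by (simp only: ee[OF lorentz_ge_1[OF w]] inner_self_eq_lorentz[OF w])
    then have "norm w = norm (e i (lorentz w))" by (simp add: norm_eq_sqrt_inner)
    then show ?thesis
      unfolding g_def using endomorphism_lorentz_cong[OF n f w eb[OF lorentz_ge_1[OF w]]] by blast
  qed
  have mult: "g (s * t) = g s * g t" if "s \<ge> 1" "t \<ge> 1" for s t
  proof -
    let ?x = "e i s" and ?y = "e j t"
    have xy: "?x \<in> unit_ball" "?y \<in> unit_ball" using eb that by blast+
    have o: "?x \<bullet> ?y = 0" using ij by (simp add: e_def inner_axis_axis)
    have "lorentz (?x \<oplus>\<^sub>E ?y) = s * t"
      using lorentz_einstein_add[OF xy] by (simp add: o le that)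
    then have "g (s * t) = lorentz (f (?x \<oplus>\<^sub>E ?y))" using g einstein_add_closed[OF xy] by metis
    also have "\<dots> = lorentz (f ?x) * lorentz (f ?y)"
      using lorentz_einstein_add[OF xy[THEN endomorphism_in_ball[OF f]]]
      by (simp add: endomorphism_add[OF f xy] endomorphism_orthogonal[OF n f xy o])
    also have "\<dots> = g s * g t" using g xy by (simp add: le that)
    finally show ?thesis .
  qed
  have self: "lorentz (x \<oplus>\<^sub>E x) = 2 * (lorentz x)^2 - 1" if x: "x \<in> unit_ball" for x :: "real ^ 'n"
    using lorentz_ge_1[OF x] unfolding lorentz_einstein_add[OF x x] inner_self_eq_lorentz[OF x]
    by (simp add: field_simps power2_eq_square)
  have dbl: "g (2 * s - 1) = 2 * g s - 1" if "s \<ge> 1" for s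
  proof -
    \<comment> \<open>Adding a vector to itself squares its Lorentz factor, so starting from
      \<open>sqrt s\<close> yields \<open>2 * s - 1\<close>; multiplicativity turns
      \<open>(g (sqrt s))^2\<close> back into \<open>g s\<close>.\<close>
    have q: "sqrt s \<ge> 1" "(sqrt s)^2 = s" using that by auto
    let ?x = "e i (sqrt s)"
    have x: "?x \<in> unit_ball" using eb q by blast
    have "lorentz (?x \<oplus>\<^sub>E ?x) = 2 * s - 1" using self[OF x] q by (simp add: le)
    then have "g (2 * s - 1) = lorentz (f (?x \<oplus>\<^sub>E ?x))" using g einstein_add_closed[OF x x] by metis
    also have "\<dots> = 2 * (g (sqrt s))^2 - 1"
      using self[OF endomorphism_in_ball[OF f x]] g[OF x] by (simp add: endomorphism_add[OF f x x] le[OF q(1)])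
    also have "(g (sqrt s))^2 = g s" using mult[OF q(1) q(1)] q(2) by (simp add: power2_eq_square)
    finally show ?thesis .
  qed
  have ge: "g s \<ge> 1" if "s \<ge> 1" for s
    unfolding g_def using lorentz_ge_1 endomorphism_in_ball[OF f] eb that by blast
  have "\<exists>s\<ge>1. g s \<noteq> 1"
  proof -
    obtain w where w: "w \<in> unit_ball" "f w \<noteq> 0" using nontriv by blast
    have "lorentz (f w) \<noteq> 1"
      using inner_self_eq_lorentz[OF endomorphism_in_ball[OF f w(1)]] w(2) by auto
    then show ?thesis using g[OF w(1)] lorentz_ge_1[OF w(1)] by auto
  qed
  then show ?thesis
    using multiplicative_doubling_imp_id[OF ge mult dbl _ lorentz_ge_1[OF u]] g[OF u] by simp
qed

text \<open>In the product formula for \<open>u \<oplus>\<^sub>E v\<close> all three Lorentz factors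
  are preserved, hence so is the remaining term.\<close>

lemma endomorphism_inner_eq:
  fixes u v :: "real ^ 'n"
  assumes n: "CARD('n) \<ge> 2" and f: "einstein_endomorphism f"
    and nontriv: "\<exists>w\<in>unit_ball. f w \<noteq> 0" and uv: "u \<in> unit_ball" "v \<in> unit_ball"
  shows "f u \<bullet> f v = u \<bullet> v"
proof -
  have fb: "f u \<in> unit_ball" "f v \<in> unit_ball" using endomorphism_in_ball[OF f] uv by blast+
  have "lorentz (f u \<oplus>\<^sub>E f v) = lorentz (u \<oplus>\<^sub>E v)"
    using endomorphism_lorentz_eq[OF n f nontriv einstein_add_closed[OF uv]]
    by (simp add: endomorphism_add[OF f uv])
  moreover have "lorentz (f u) = lorentz u" "lorentz (f v) = lorentz v"
    using endomorphism_lorentz_eq[OF n f nontriv] uv by blast+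
  ultimately have "lorentz u * lorentz v * (1 + f u \<bullet> f v) = lorentz u * lorentz v * (1 + u \<bullet> v)"
    using lorentz_einstein_add[OF uv] lorentz_einstein_add[OF fb] by simp
  then show ?thesis using lorentz_ge_1[OF uv(1)] lorentz_ge_1[OF uv(2)] by simp
qed

section \<open>Extension to orthogonal transformations\<close>

text \<open>Linearity comes for free: a map of the whole space that preserves inner products is an
  isometry fixing 0, hence orthogonal.\<close>

lemma inner_preserving_on_ball_extends:
  fixes f :: "'a::euclidean_space \<Rightarrow> 'a"
  assumes f: "\<And>u v. u \<in> ball 0 1 \<Longrightarrow> v \<in> ball 0 1 \<Longrightarrow> f u \<bullet> f v = u \<bullet> v"
  shows "\<exists>T. orthogonal_transformation T \<and> (\<forall>u\<in>ball 0 1. f u = T u)"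
proof -
  \<comment> \<open>Dividing by \<open>1 + norm x\<close> brings every \<open>x\<close> into the
    ball. That this extends \<open>f\<close> is not clear at first, since homogeneity of
    \<open>f\<close> is not assumed; it follows below from \<open>f u - T u\<close> having norm
    0.\<close>
  define T where "T x = (1 + norm x) *\<^sub>R f (x /\<^sub>R (1 + norm x))" for x
  have pos: "1 + norm x > 0" for x :: 'a by (simp add: add_pos_nonneg)
  have b: "x /\<^sub>R (1 + norm x) \<in> ball 0 1" for x :: 'a
    using pos[of x] by (simp add: field_simps)
  have inner: "T x \<bullet> T y = x \<bullet> y" for x y
  proof -
    have "T x \<bullet> T y = ((1 + norm x) * inverse (1 + norm x)) * ((1 + norm y) * inverse (1 + norm y)) * (x \<bullet> y)"
      by (simp only: T_def inner_scaleR_left inner_scaleR_right f[OF b b] mult_ac)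
    then show ?thesis using pos[of x] pos[of y] by simp
  qed
  have "T 0 \<bullet> T 0 = 0" by (simp only: inner) simp
  moreover have "dist (T x) (T y) = dist x y" for x y
    by (simp add: dist_norm norm_eq_sqrt_inner inner_diff_left inner_diff_right inner)
  ultimately have "orthogonal_transformation T" by (simp add: orthogonal_transformation_isometry)
  moreover have "f u = T u" if u: "u \<in> ball 0 1" for u
  proof -
    have "f u \<bullet> T u = u \<bullet> u" "f u \<bullet> f u = u \<bullet> u"
      using pos[of u] by (simp_all add: T_def f[OF u b] f[OF u u])
    then have "(f u - T u) \<bullet> (f u - T u) = 0"
      by (simp add: inner_diff_left inner_diff_right inner_commute[of "T u"] inner)
    then show ?thesis by simp
  qed
  ultimately show ?thesis by blast
qed

lemma orthogonal_transformation_einstein_add: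
  assumes "orthogonal_transformation T"
  shows "T (u \<oplus>\<^sub>E v) = T u \<oplus>\<^sub>E T v"
  using assms orthogonal_transformation_linear[OF assms]
  by (simp add: einstein_add_def orthogonal_transformation_norm linear_add linear_cmul orthogonal_transformation_def)

theorem theorem3:
  fixes f :: "real ^ 'n \<Rightarrow> real ^ 'n"
  assumes "CARD('n) \<ge> 2"
  shows "einstein_automorphism f \<longleftrightarrow>
    (\<exists>T :: real ^ 'n \<Rightarrow> real ^ 'n.
       orthogonal_transformation T \<and> (\<forall>u\<in>unit_ball. f u = T u))"
proof
  assume "einstein_automorphism f"
  then have f: "einstein_endomorphism f" and bij: "bij_betw f unit_ball unit_ball"
    by (auto simp: einstein_automorphism_def)
  have "\<exists>w\<in>unit_ball. f w \<noteq> 0"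
  proof -
    \<comment> \<open>Surjectivity is used only here, to rule out the zero map.\<close>
    obtain y :: "real ^ 'n" where y: "norm y = 1/2" using vector_choose_size[of "1/2"] by auto
    then have "y \<in> f ` unit_ball" using bij by (simp add: bij_betw_def)
    then show ?thesis using y by force
  qed
  then show "\<exists>T. orthogonal_transformation T \<and> (\<forall>u\<in>unit_ball. f u = T u)"
    using inner_preserving_on_ball_extends endomorphism_inner_eq[OF assms f] by blast
next
  assume "\<exists>T :: real ^ 'n \<Rightarrow> real ^ 'n. orthogonal_transformation T \<and> (\<forall>u\<in>unit_ball. f u = T u)"
  then obtain T :: "real ^ 'n \<Rightarrow> real ^ 'n"
    where T: "orthogonal_transformation T" and fT: "\<And>u. u \<in> unit_ball \<Longrightarrow> f u = T u" by blast
  have "bij_betw T unit_ball unit_ball"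
    using image_orthogonal_transformation_ball[OF T, of 0 1] orthogonal_transformation_inj[OF T]
      linear_0[OF orthogonal_transformation_linear[OF T]]
    by (auto simp: bij_betw_def intro: inj_on_subset)
  then have bij: "bij_betw f unit_ball unit_ball"
    using bij_betw_cong[of unit_ball f T] fT by blast
  moreover have "f (u \<oplus>\<^sub>E v) = f u \<oplus>\<^sub>E f v" if "u \<in> unit_ball" "v \<in> unit_ball" for u v
    using fT that einstein_add_closed[OF that] orthogonal_transformation_einstein_add[OF T] by metis
  ultimately show "einstein_automorphism f"
    unfolding einstein_automorphism_def einstein_endomorphism_def
    using bij_betw_imp_funcset by blast
qed

end
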